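(* Let $G=(V,E)$ be a finite simple graph on $|V|\ge 4$ vertices with a spanning forest $F\subseteq E$ of at least $3$ edges, and let $$P=\Big\{x\in\mathbb{R}^{E} : \sum_{e\in E(G[U])}x(e)\le |U|-1\ \ \forall\,\emptyset\neq U\subseteq V,\quad x(e)\ge 0\ \ \forall e\in E\Big\}.$$ Then $P$ has circuit diameter at least $3$.
   Context: $G[U]$ is the subgraph of $G$ induced by $U$. A spanning forest of $G$ is a set of edges forming a spanning tree in each connected component of $G$. Let $B$ be the inequality constraint matrix of the given description of $P$ (there are no equality constraints). The circuits of $P$ are the vectors $g\in\mathbb{R}^E\setminus\{0\}$, normalized to coprime integer components, for which the support of $Bg$ is inclusion-minimal among the supports of $\{Bx : x\in\mathbb{R}^E\setminus\{0\}\}$. A circuit walk of length $k$ in $P$ is a sequence $x_0,\ldots,x_k$ of points of $P$, with $x_0$ an extreme point, such that for each $i=0,\ldots,k-1$, $x_{i+1}=x_i+\epsilon_i g_i$ for some circuit $g_i$ and $\epsilon_i>0$, where $x_i+\epsilon g_i\notin P$ for all $\epsilon>\epsilon_i$. The circuit diameter of $P$ is the maximum, over all ordered pairs $(u,v)$ of extreme points of $P$, of the minimum length of a circuit walk from $u$ to $v$. *)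

theory Defs
  imports "HOL-Analysis.Analysis" "HOL-Library.Extended_Nat"
begin

section \<open>Simple graphs and spanning forests\<close>

definition simple_graph :: "'v set \<Rightarrow> 'v set set \<Rightarrow> bool" where
  "simple_graph V E \<longleftrightarrow> finite V \<and> (\<forall>e\<in>E. e \<subseteq> V \<and> card e = 2)"

definition induced_edges :: "'v set set \<Rightarrow> 'v set \<Rightarrow> 'v set set" where
  "induced_edges E U = {e \<in> E. e \<subseteq> U}"

definition adj :: "'v set set \<Rightarrow> ('v \<times> 'v) set" where
  "adj E = {(u, v). {u, v} \<in> E}"

definition connected_graph :: "'v set \<Rightarrow> 'v set set \<Rightarrow> bool" where
  "connected_graph V E \<longleftrightarrow> V \<noteq> {} \<and> (\<forall>u\<in>V. \<forall>v\<in>V. (u, v) \<in> (adj E)\<^sup>*)"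

definition is_cycle :: "'v set set \<Rightarrow> 'v list \<Rightarrow> bool" where
  "is_cycle E c \<longleftrightarrow> length c \<ge> 3 \<and> distinct c \<and>
     (\<forall>i<length c. {c ! i, c ! (Suc i mod length c)} \<in> E)"

definition is_tree :: "'v set \<Rightarrow> 'v set set \<Rightarrow> bool" where
  "is_tree V E \<longleftrightarrow> connected_graph V E \<and> (\<nexists>c. is_cycle E c)"

definition components_of_graph :: "'v set \<Rightarrow> 'v set set \<Rightarrow> 'v set set" where
  "components_of_graph V E = (\<lambda>u. {v. (u, v) \<in> (adj E)\<^sup>*}) ` V"

definition spanning_forest :: "'v set \<Rightarrow> 'v set set \<Rightarrow> 'v set set \<Rightarrow> bool" where
  "spanning_forest V E F \<longleftrightarrow> F \<subseteq> E \<and>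
     (\<forall>C \<in> components_of_graph V E. is_tree C (induced_edges F C))"


section \<open>The polytope and its inequality description\<close>

text \<open>The space of real vectors indexed by \<open>E\<close> is realised as the coordinate subspace of
  the vectors indexed by all vertex sets that vanish outside \<open>E\<close>.\<close>

definition edge_space :: "'v set set \<Rightarrow> (real ^ ('v::finite set)) set" where
  "edge_space E = {x. \<forall>e. e \<notin> E \<longrightarrow> x $ e = 0}"

definition forest_polytope :: "'v set \<Rightarrow> 'v set set \<Rightarrow> (real ^ ('v::finite set)) set" where
  "forest_polytope V E = {x \<in> edge_space E.
     (\<forall>U. U \<noteq> {} \<and> U \<subseteq> V \<longrightarrow> (\<Sum>e\<in>induced_edges E U. x $ e) \<le> real (card U) - 1) \<and>
     (\<forall>e\<in>E. x $ e \<ge> 0)}"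

datatype 'v constraint = Rank "'v set" | Nonneg "'v set"

definition constraint_rows :: "'v set \<Rightarrow> 'v set set \<Rightarrow> 'v constraint set" where
  "constraint_rows V E = Rank ` {U. U \<noteq> {} \<and> U \<subseteq> V} \<union> Nonneg ` E"

fun constraint_matrix :: "'v set set \<Rightarrow> 'v constraint \<Rightarrow> 'v set \<Rightarrow> real" where
  "constraint_matrix E (Rank U) e = (if e \<in> induced_edges E U then 1 else 0)"
| "constraint_matrix E (Nonneg f) e = (if e = f then - 1 else 0)"

fun constraint_rhs :: "'v constraint \<Rightarrow> real" where
  "constraint_rhs (Rank U) = real (card U) - 1"
| "constraint_rhs (Nonneg f) = 0"

definition constraint_apply :: "'v set set \<Rightarrow> real ^ ('v::finite set) \<Rightarrow> 'v constraint \<Rightarrow> real" where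
  "constraint_apply E x i = (\<Sum>e\<in>E. constraint_matrix E i e * x $ e)"

lemma forest_polytope_eq_constraints:
  fixes E :: "'v::finite set set"
  shows "forest_polytope V E =
    {x \<in> edge_space E. \<forall>i\<in>constraint_rows V E. constraint_apply E x i \<le> constraint_rhs i}"
proof -
  have 1: "constraint_apply E x (Rank U) = (\<Sum>e\<in>induced_edges E U. x $ e)"
    for x :: "real ^ ('v set)" and U
  proof -
    have "constraint_apply E x (Rank U) =
        (\<Sum>e\<in>E. if e \<in> induced_edges E U then x $ e else 0)"
      unfolding constraint_apply_def by (intro sum.cong) auto
    also have "\<dots> = (\<Sum>e\<in>E \<inter> induced_edges E U. x $ e)"
      by (simp add: sum.inter_restrict)
    also have "E \<inter> induced_edges E U = induced_edges E U"
      by (auto simp: induced_edges_def)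
    finally show ?thesis .
  qed
  have 2: "constraint_apply E x (Nonneg f) = - x $ f" if "f \<in> E"
    for x :: "real ^ ('v set)" and f
  proof -
    have "constraint_apply E x (Nonneg f) = (\<Sum>e\<in>E. if e = f then - x $ e else 0)"
      unfolding constraint_apply_def by (intro sum.cong) auto
    then show ?thesis using that by simp
  qed
  show ?thesis
    unfolding forest_polytope_def constraint_rows_def ball_Un by (simp add: 1 2)
qed


section \<open>Circuits, circuit walks and the circuit diameter\<close>

definition constraint_support ::
    "'v set \<Rightarrow> 'v set set \<Rightarrow> real ^ ('v::finite set) \<Rightarrow> 'v constraint set" where
  "constraint_support V E x = {i \<in> constraint_rows V E. constraint_apply E x i \<noteq> 0}"

definition coprime_integral :: "'v set set \<Rightarrow> real ^ ('v::finite set) \<Rightarrow> bool" where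
  "coprime_integral E g \<longleftrightarrow>
     (\<exists>z :: 'v set \<Rightarrow> int. (\<forall>e\<in>E. g $ e = of_int (z e)) \<and> Gcd (z ` E) = 1)"

definition circuit :: "'v set \<Rightarrow> 'v set set \<Rightarrow> real ^ ('v::finite set) \<Rightarrow> bool" where
  "circuit V E g \<longleftrightarrow> g \<in> edge_space E - {0} \<and> coprime_integral E g \<and>
     \<not> (\<exists>x \<in> edge_space E - {0}. constraint_support V E x \<subset> constraint_support V E g)"

definition circuit_walk ::
    "'v set \<Rightarrow> 'v set set \<Rightarrow> nat \<Rightarrow> (nat \<Rightarrow> real ^ ('v::finite set)) \<Rightarrow> bool" where
  "circuit_walk V E k x \<longleftrightarrow>
     x 0 extreme_point_of forest_polytope V E \<and>
     (\<forall>i\<le>k. x i \<in> forest_polytope V E) \<and>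
     (\<forall>i<k. \<exists>g \<epsilon>. circuit V E g \<and> \<epsilon> > 0 \<and> x (Suc i) = x i + \<epsilon> *\<^sub>R g \<and>
        (\<forall>\<delta>>\<epsilon>. x i + \<delta> *\<^sub>R g \<notin> forest_polytope V E))"

text \<open>Lengths are extended naturals; the distance would be \<open>\<infinity>\<close> if no circuit walk existed.
  As there are finitely many extreme points, the supremum in the diameter is a maximum.\<close>

definition circuit_distance ::
    "'v set \<Rightarrow> 'v set set \<Rightarrow> real ^ ('v::finite set) \<Rightarrow> real ^ ('v set) \<Rightarrow> enat" where
  "circuit_distance V E u v =
     (INF k \<in> {k. \<exists>x. circuit_walk V E k x \<and> x 0 = u \<and> x k = v}. enat k)"

definition circuit_diameter :: "('v::finite) set \<Rightarrow> 'v set set \<Rightarrow> enat" where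
  "circuit_diameter V E =
     (SUP (u, v) \<in> {u. u extreme_point_of forest_polytope V E} \<times>
                   {v. v extreme_point_of forest_polytope V E}. circuit_distance V E u v)"

end

theory Submission imports Defs begin

text \<open>The two far-apart extreme points are the origin and the incidence vector of the spanning
  forest \<open>F\<close>.  The whole argument is that a vector cannot be a circuit direction if some unit
  vector has a strictly smaller constraint support (\<open>unit_vector_excludes_circuit\<close>).

  A step leaving the origin stays in the nonnegative orthant, and a nonnegative vector with two
  positive entries has a larger support than either of the corresponding unit vectors.  So the
  first step runs along one edge \<open>f\<close> and ends at a point \<open>t\<close> times the unit vector of \<open>f\<close> with
  \<open>0 < t \<le> 1\<close> (\<open>circuit_step_from_origin\<close>).

  From there \<open>F\<close> cannot be reached in a single step.  The direction would be a multiple of the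
  incidence vector of \<open>F\<close> minus \<open>t\<close> at \<open>f\<close>.  If \<open>f \<in> F\<close>, this is nonnegative and positive on
  two edges at least, since \<open>F\<close> has three edges.  If \<open>f \<notin> F\<close>, the rank
  rows could only make the vector a circuit if, for every \<open>h \<in> F\<close>, the value \<open>-t\<close> at \<open>f\<close> cancelled
  the value \<open>1\<close> at \<open>h\<close> on some vertex set containing both edges, and then \<open>h\<close> would be the only
  forest edge inside \<open>f \<union> h\<close>.  But \<open>F\<close> joins the two ends of \<open>f\<close>, and the beginning of
  the joining path provides two forest edges \<open>h\<close>, \<open>h'\<close> with \<open>h' \<subseteq> f \<union> h\<close>
  (\<open>forest_edge_pair_near_nonforest_edge\<close>).

  That the incidence vector of \<open>F\<close> lies in the polytope is the bound \<open>|U| - 1\<close> on the number of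
  edges that an acyclic graph has on a vertex set \<open>U\<close> (\<open>acyclic_card_induced_edges\<close>); it is
  extreme there because the polytope is contained in the unit cube.\<close>

section \<open>Acyclic graphs have few edges\<close>

text \<open>In a longest path, all neighbours of the first vertex lie on the path, and the one that is
  not its successor closes a cycle.\<close>

lemma min_degree_two_imp_cycle:
  fixes F :: "'v set set"
  assumes fin: "finite U" and ne: "U \<noteq> {}"
    and two: "\<And>e. e \<in> F \<Longrightarrow> card e = 2"
    and deg: "\<And>v w. v \<in> U \<Longrightarrow> \<exists>w'\<in>U. w' \<noteq> w \<and> {v, w'} \<in> F"
  shows "\<exists>c. is_cycle F c"
proof -
  define path where "path p \<longleftrightarrow> p \<noteq> [] \<and> distinct p \<and> set p \<subseteq> U \<and>
    (\<forall>i. Suc i < length p \<longrightarrow> {p ! i, p ! Suc i} \<in> F)" for p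
  obtain u where "u \<in> U" using ne by blast
  then have "path [u]" by (simp add: path_def)
  moreover have "length p \<le> card U" if "path p" for p
    using that fin unfolding path_def by (metis card_mono distinct_card)
  ultimately obtain p where p: "path p" and longest: "\<And>q. path q \<Longrightarrow> length q \<le> length p"
    using ex_has_greatest_nat[of path "[u]" length "Suc (card U)"] by (auto simp: less_Suc_eq_le)
  have pne: "p \<noteq> []" and dist: "distinct p" and sub: "set p \<subseteq> U"
    and edges: "\<And>i. Suc i < length p \<Longrightarrow> {p ! i, p ! Suc i} \<in> F"
    using p by (auto simp: path_def)
  have "p ! 0 \<in> U" using pne sub by (metis length_greater_0_conv nth_mem subsetD)
  then obtain w where w: "w \<in> U" "w \<noteq> p ! 1" "{p ! 0, w} \<in> F" using deg by blast
  have "w \<in> set p"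
  proof (rule ccontr)
    assume new: "w \<notin> set p"
    have "{(w # p) ! i, (w # p) ! Suc i} \<in> F" if "Suc i < length (w # p)" for i
      using that edges w(3) by (cases i) (auto simp: insert_commute)
    then have "path (w # p)"
      using new dist sub w(1) by (auto simp: path_def)
    then show False using longest by fastforce
  qed
  then obtain i where i: "i < length p" "p ! i = w" by (meson in_set_conv_nth)
  have "w \<noteq> p ! 0" using two[OF w(3)] by auto
  then have "i \<noteq> 0" "i \<noteq> 1" using i w(2) by (metis, metis)
  then have i2: "i \<ge> 2" by simp
  define c where "c = take (Suc i) p"
  have len: "length c = Suc i" using i by (simp add: c_def)
  have "{c ! j, c ! (Suc j mod length c)} \<in> F" if "j < length c" for j
  proof (cases "j = i")
    case True
    then show ?thesis using w(3) i pne len by (simp add: c_def insert_commute)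
  next
    case False
    then have "j < i" using that len by simp
    then show ?thesis using edges[of j] i len by (simp add: c_def)
  qed
  then have "is_cycle F c"
    using len i2 dist by (simp add: is_cycle_def c_def)
  then show ?thesis by blast
qed

lemma acyclic_card_induced_edges:
  fixes F :: "'v set set"
  assumes "finite U" "U \<noteq> {}"
    and two: "\<And>e. e \<in> F \<Longrightarrow> card e = 2"
    and acyc: "\<nexists>c. is_cycle F c"
  shows "card (induced_edges F U) + 1 \<le> card U"
  using assms(1,2)
proof (induction "card U" arbitrary: U rule: less_induct)
  case less
  have "\<exists>v\<in>U. \<exists>w. \<forall>w'\<in>U. {v, w'} \<in> F \<longrightarrow> w' = w"
    using min_degree_two_imp_cycle[of U F] less.prems two acyc by blast
  then obtain v w where v: "v \<in> U" and leaf: "\<And>w'. w' \<in> U \<Longrightarrow> {v, w'} \<in> F \<Longrightarrow> w' = w"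
    by blast
  have fin: "finite (induced_edges F (U - {v}))"
    using less.prems(1) by (auto simp: induced_edges_def intro: finite_subset[of _ "Pow U"])
  have sub: "induced_edges F U \<subseteq> insert {v, w} (induced_edges F (U - {v}))"
  proof
    fix e assume e: "e \<in> induced_edges F U"
    show "e \<in> insert {v, w} (induced_edges F (U - {v}))"
    proof (cases "v \<in> e")
      case True
      have "card e = 2" using e two by (auto simp: induced_edges_def)
      then obtain w' where "e = {v, w'}"
        using True by (auto simp: card_2_iff insert_commute)
      then show ?thesis using e leaf by (auto simp: induced_edges_def)
    qed (use e in \<open>auto simp: induced_edges_def\<close>)
  qed
  have card_le: "card (induced_edges F U) \<le> Suc (card (induced_edges F (U - {v})))"
    using card_mono[OF _ sub] fin by (simp add: card_insert_if split: if_splits)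
  show ?case
  proof (cases "U = {v}")
    case True
    have "induced_edges F U = {}"
    proof (rule ccontr)
      assume "induced_edges F U \<noteq> {}"
      then obtain e where "e \<in> F" "e \<subseteq> {v}" using True by (auto simp: induced_edges_def)
      then show False using two[of e] card_mono[of "{v}" e] by simp
    qed
    then show ?thesis using True by simp
  next
    case False
    have "card (U - {v}) < card U" using v less.prems(1) by (simp only: card_Diff1_less)
    moreover have "U - {v} \<noteq> {}" using False v by blast
    ultimately show ?thesis using less.hyps[of "U - {v}"] less.prems(1) card_le by simp
  qed
qed

section \<open>Spanning forests\<close>

lemma spanning_forest_acyclic:
  assumes G: "simple_graph V E" and F: "spanning_forest V E F"
  shows "\<nexists>c. is_cycle F c"
proof
  assume "\<exists>c. is_cycle F c"
  then obtain c where c: "is_cycle F c" ..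
  have FE: "F \<subseteq> E" using F by (simp add: spanning_forest_def)
  have len: "length c \<ge> 3"
    and edge: "\<And>i. i < length c \<Longrightarrow> {c ! i, c ! (Suc i mod length c)} \<in> F"
    using c by (auto simp: is_cycle_def)
  \<comment> \<open>A cycle is connected, hence lies in the component of its first vertex.\<close>
  define C where "C = {v. (c ! 0, v) \<in> (adj E)\<^sup>*}"
  have "{c ! 0, c ! (Suc 0 mod length c)} \<in> E" using edge[of 0] len FE by fastforce
  then have "c ! 0 \<in> V" using G by (auto simp: simple_graph_def)
  then have "C \<in> components_of_graph V E" by (auto simp: components_of_graph_def C_def)
  then have acyc: "\<nexists>c. is_cycle (induced_edges F C) c"
    using F by (simp add: spanning_forest_def is_tree_def)
  have inC: "c ! i \<in> C" if "i < length c" for i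
    using that
  proof (induction i)
    case (Suc i)
    have "(c ! i, c ! Suc i) \<in> adj E" using edge[of i] Suc.prems FE by (auto simp: adj_def)
    then show ?case using Suc by (auto simp: C_def intro: rtrancl_into_rtrancl)
  qed (simp add: C_def)
  have "{c ! i, c ! (Suc i mod length c)} \<in> induced_edges F C" if "i < length c" for i
  proof -
    have "Suc i mod length c < length c" using len by (intro mod_less_divisor) auto
    then show ?thesis using edge[OF that] inC that by (simp add: induced_edges_def)
  qed
  then have "is_cycle (induced_edges F C) c" using c by (simp add: is_cycle_def)
  then show False using acyc by blast
qed

text \<open>Let \<open>f = {a, b}\<close>.  The forest path from \<open>a\<close> to \<open>b\<close> has length at least two, so it has to
  leave the star of forest edges around \<open>a\<close>.  An edge \<open>h\<close> doing so starts at a neighbour \<open>p\<close> of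
  \<open>a\<close>, and \<open>h' = {a, p}\<close>.\<close>

lemma forest_edge_pair_near_nonforest_edge:
  assumes G: "simple_graph V E" and F: "spanning_forest V E F"
    and f: "f \<in> E" "f \<notin> F"
  shows "\<exists>h\<in>F. \<exists>h'\<in>F. h \<noteq> h' \<and> h' \<subseteq> f \<union> h"
proof (rule ccontr)
  assume none: "\<not> ?thesis"
  have "card f = 2" "f \<subseteq> V" using G f by (auto simp: simple_graph_def)
  then obtain a b where ab: "f = {a, b}" "a \<noteq> b" "a \<in> V"
    by (auto simp: card_2_iff)
  define C where "C = {v. (a, v) \<in> (adj E)\<^sup>*}"
  have "C \<in> components_of_graph V E" using ab by (auto simp: components_of_graph_def C_def)
  then have "connected_graph C (induced_edges F C)"
    using F by (simp add: spanning_forest_def is_tree_def)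
  moreover have "a \<in> C" "b \<in> C" using f ab by (auto simp: C_def adj_def)
  ultimately have "(a, b) \<in> (adj (induced_edges F C))\<^sup>*" by (simp add: connected_graph_def)
  then have "b = a \<or> {a, b} \<in> F"
  proof (induction rule: rtrancl_induct)
    case (step p q)
    have pq: "{p, q} \<in> F" using step.hyps(2) by (simp add: adj_def induced_edges_def)
    show ?case
    proof (cases "p = a \<or> q = a")
      case True
      then show ?thesis using pq by auto
    next
      case False
      then have "{a, p} \<in> F" using step.IH by simp
      moreover have "{p, q} \<noteq> {a, p}" using False by auto
      moreover have "{a, p} \<subseteq> f \<union> {p, q}" using ab by auto
      ultimately have "\<exists>h\<in>F. \<exists>h'\<in>F. h \<noteq> h' \<and> h' \<subseteq> f \<union> h"
        using pq by (intro bexI[of _ "{p, q}"] bexI[of _ "{a, p}"] conjI)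
      then show ?thesis using none by simp
    qed
  qed simp
  then show False using ab f by simp
qed

section \<open>The forest polytope\<close>

lemma constraint_apply_Rank:
  fixes x :: "real ^ ('v::finite set)"
  shows "constraint_apply E x (Rank U) = (\<Sum>e\<in>induced_edges E U. x $ e)"
proof -
  have "constraint_apply E x (Rank U) = (\<Sum>e\<in>E. if e \<in> induced_edges E U then x $ e else 0)"
    unfolding constraint_apply_def by (intro sum.cong) auto
  also have "\<dots> = (\<Sum>e\<in>E \<inter> induced_edges E U. x $ e)"
    by (simp add: sum.inter_restrict)
  also have "E \<inter> induced_edges E U = induced_edges E U"
    by (auto simp: induced_edges_def)
  finally show ?thesis .
qed

lemma constraint_apply_Nonneg:
  fixes x :: "real ^ ('v::finite set)"
  assumes "f \<in> E"
  shows "constraint_apply E x (Nonneg f) = - x $ f"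
proof -
  have "constraint_apply E x (Nonneg f) = (\<Sum>e\<in>E. if e = f then - x $ e else 0)"
    unfolding constraint_apply_def by (intro sum.cong) auto
  then show ?thesis using assms by simp
qed

lemma forest_polytope_in_unit_cube:
  fixes x :: "real ^ ('v::finite set)"
  assumes G: "simple_graph V E" and x: "x \<in> forest_polytope V E"
  shows "0 \<le> x $ e \<and> x $ e \<le> 1"
proof (cases "e \<in> E")
  case True
  then have e: "card e = 2" "e \<subseteq> V" using G by (auto simp: simple_graph_def)
  then have "e \<noteq> {}" by auto
  then have "(\<Sum>e\<in>induced_edges E e. x $ e) \<le> real (card e) - 1"
    using x e by (auto simp: forest_polytope_def)
  moreover have "induced_edges E e = {e}"
  proof -
    have "e' = e" if "e' \<in> E" "e' \<subseteq> e" for e'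
      using card_subset_eq[OF finite that(2)] that(1) True G by (simp add: simple_graph_def)
    then show ?thesis using True by (auto simp: induced_edges_def)
  qed
  ultimately show ?thesis using x True e by (auto simp: forest_polytope_def)
next
  case False
  then show ?thesis using x by (auto simp: forest_polytope_def edge_space_def)
qed

lemma zero_one_point_extreme:
  fixes x :: "real ^ ('v::finite set)"
  assumes G: "simple_graph V E" and x: "x \<in> forest_polytope V E"
    and zo: "\<And>e. x $ e \<in> {0, 1}"
  shows "x extreme_point_of forest_polytope V E"
  unfolding extreme_point_of_def
proof (intro conjI x ballI notI)
  fix a b assume a: "a \<in> forest_polytope V E" and b: "b \<in> forest_polytope V E"
    and "x \<in> open_segment a b"
  then obtain u where u: "a \<noteq> b" "0 < u" "u < 1" "x = (1 - u) *\<^sub>R a + u *\<^sub>R b"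
    by (auto simp: in_segment)
  have "a $ e = b $ e" for e
  proof -
    have bounds: "0 \<le> a $ e" "a $ e \<le> 1" "0 \<le> b $ e" "b $ e \<le> 1"
      using forest_polytope_in_unit_cube[OF G] a b by auto
    have xe: "x $ e = (1 - u) * a $ e + u * b $ e" using u(4) by simp
    show ?thesis
    proof (cases "x $ e = 0")
      case True
      have "0 \<le> (1 - u) * a $ e" "0 \<le> u * b $ e" using bounds u by auto
      then have "(1 - u) * a $ e = 0" "u * b $ e = 0" using xe True by linarith+
      then show ?thesis using u by simp
    next
      case False
      then have "(1 - u) * (1 - a $ e) + u * (1 - b $ e) = 0"
        using xe zo[of e] by (simp add: algebra_simps)
      moreover have "0 \<le> (1 - u) * (1 - a $ e)" "0 \<le> u * (1 - b $ e)" using bounds u by auto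
      ultimately have "(1 - u) * (1 - a $ e) = 0" "u * (1 - b $ e) = 0" by linarith+
      then show ?thesis using u by simp
    qed
  qed
  then show False using u(1) by (simp add: vec_eq_iff)
qed

lemma origin_in_forest_polytope:
  "0 \<in> forest_polytope V (E :: 'v::finite set set)"
proof -
  have "1 \<le> real (card U)" if "U \<noteq> {}" for U :: "'v set"
    using that by (simp add: Suc_le_eq card_gt_0_iff)
  then show ?thesis by (auto simp: forest_polytope_def edge_space_def)
qed

definition incidence_vector :: "'v set set \<Rightarrow> real ^ ('v::finite set)" where
  "incidence_vector F = (\<chi> e. if e \<in> F then 1 else 0)"

lemma incidence_vector_nth [simp]: "incidence_vector F $ e = (if e \<in> F then 1 else 0)"
  by (simp add: incidence_vector_def)

lemma sum_incidence_vector: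
  assumes "F \<subseteq> E"
  shows "(\<Sum>e\<in>induced_edges E U. incidence_vector F $ e) = real (card (induced_edges F U))"
proof -
  have "induced_edges E U \<inter> F = induced_edges F U"
    using assms by (auto simp: induced_edges_def)
  then show ?thesis by (simp add: sum.If_cases)
qed

lemma incidence_vector_in_forest_polytope:
  fixes F :: "'v::finite set set"
  assumes G: "simple_graph V E" and F: "spanning_forest V E F"
  shows "incidence_vector F \<in> forest_polytope V E"
proof -
  have FE: "F \<subseteq> E" using F by (simp add: spanning_forest_def)
  have "real (card (induced_edges F U)) \<le> real (card U) - 1" if "U \<noteq> {}" for U
    using acyclic_card_induced_edges[of U F] that spanning_forest_acyclic[OF G F] FE G
    by (force simp: simple_graph_def)
  then show ?thesis
    using FE by (auto simp: forest_polytope_def edge_space_def sum_incidence_vector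
      simp del: incidence_vector_nth) auto
qed

section \<open>Circuit steps\<close>

text \<open>The rows on which the unit vector of \<open>h\<close> is nonzero are the nonnegativity row of \<open>h\<close> and the
  rank rows of the vertex sets containing \<open>h\<close>.  If \<open>x\<close> is nonzero on all of them, and also at
  another edge \<open>f\<close>, the unit vector has strictly smaller support.\<close>

lemma unit_vector_excludes_circuit:
  fixes g x :: "real ^ ('v::finite set)"
  assumes g: "circuit V E g" and x: "x = c *\<^sub>R g"
    and h: "h \<in> E" "x $ h \<noteq> 0"
    and rank: "\<And>U. h \<subseteq> U \<Longrightarrow> (\<Sum>e\<in>induced_edges E U. x $ e) \<noteq> 0"
    and f: "f \<in> E" "f \<noteq> h"
  shows "x $ f = 0"
proof (rule ccontr)
  assume xf: "x $ f \<noteq> 0"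
  let ?y = "axis h 1 :: real ^ ('v set)"
  have "?y \<in> edge_space E - {0}"
    using h(1) by (auto simp: edge_space_def axis_def vec_eq_iff)
  moreover have "constraint_support V E ?y \<subseteq> constraint_support V E g"
  proof
    fix i assume i: "i \<in> constraint_support V E ?y"
    show "i \<in> constraint_support V E g"
    proof (cases i)
      case (Rank U)
      have "h \<subseteq> U"
      proof (rule ccontr)
        assume "\<not> h \<subseteq> U"
        then have "(\<Sum>e\<in>induced_edges E U. ?y $ e) = 0"
          by (intro sum.neutral) (auto simp: axis_def induced_edges_def)
        then show False using i Rank by (simp add: constraint_support_def constraint_apply_Rank)
      qed
      from rank[OF this] have "(\<Sum>e\<in>induced_edges E U. g $ e) \<noteq> 0"
        by (simp add: x flip: sum_distrib_left)
      then show ?thesis using i Rank by (simp add: constraint_support_def constraint_apply_Rank)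
    next
      case (Nonneg e)
      then have e: "e \<in> E" using i by (auto simp: constraint_support_def constraint_rows_def)
      then have "?y $ e \<noteq> 0"
        using i Nonneg by (simp add: constraint_support_def constraint_apply_Nonneg)
      then have "g $ e \<noteq> 0" using h(2) x by (auto simp: axis_def split: if_splits)
      then show ?thesis
        using i Nonneg e by (simp add: constraint_support_def constraint_apply_Nonneg)
    qed
  qed
  moreover have "Nonneg f \<in> constraint_support V E g - constraint_support V E ?y"
    using f xf x
    by (auto simp: constraint_support_def constraint_rows_def constraint_apply_Nonneg axis_def)
  ultimately have "\<exists>y\<in>edge_space E - {0}. constraint_support V E y \<subset> constraint_support V E g"
    by blast
  then show False using g by (simp add: circuit_def)
qed

lemma circuit_step_from_origin:
  fixes g :: "real ^ ('v::finite set)"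
  assumes G: "simple_graph V E" and g: "circuit V E g" and eps: "\<epsilon> > 0"
    and P: "\<epsilon> *\<^sub>R g \<in> forest_polytope V E"
  obtains f t where "f \<in> E" "0 < t" "t \<le> 1" "\<epsilon> *\<^sub>R g = t *\<^sub>R axis f 1"
proof -
  define x where "x = \<epsilon> *\<^sub>R g"
  have cube: "0 \<le> x $ e" "x $ e \<le> 1" for e
    using forest_polytope_in_unit_cube[OF G P] by (auto simp: x_def)
  have out: "x $ e = 0" if "e \<notin> E" for e
    using P that by (auto simp: x_def forest_polytope_def edge_space_def)
  have "x \<noteq> 0" using g eps by (simp add: x_def circuit_def)
  then obtain f where xf: "x $ f \<noteq> 0" by (auto simp: vec_eq_iff)
  then have f: "f \<in> E" using out by blast
  have pos: "x $ f > 0" using xf cube(1)[of f] by simp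
  have rank: "(\<Sum>e\<in>induced_edges E U. x $ e) \<noteq> 0" if "f \<subseteq> U" for U
  proof -
    have "f \<in> induced_edges E U" using f that by (simp add: induced_edges_def)
    then have "x $ f \<le> (\<Sum>e\<in>induced_edges E U. x $ e)"
      using cube(1) by (intro member_le_sum) auto
    then show ?thesis using pos by simp
  qed
  have "x $ e = 0" if "e \<noteq> f" for e
    using unit_vector_excludes_circuit[OF g x_def f xf rank, of e] that out by blast
  then have "x = x $ f *\<^sub>R axis f 1" by (auto simp: vec_eq_iff axis_def)
  then show thesis using that[OF f pos cube(2)] by (simp add: x_def)
qed

lemma no_circuit_step_from_edge_to_forest:
  fixes g :: "real ^ ('v::finite set)"
  assumes G: "simple_graph V E" and F: "spanning_forest V E F" and F3: "card F \<ge> 3"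
    and f: "f \<in> E" and t: "0 < t" "t \<le> 1" and g: "circuit V E g"
  shows "incidence_vector F \<noteq> t *\<^sub>R axis f 1 + c *\<^sub>R g"
proof
  assume eq: "incidence_vector F = t *\<^sub>R axis f 1 + c *\<^sub>R g"
  define x where "x = c *\<^sub>R g"
  have FE: "F \<subseteq> E" using F by (simp add: spanning_forest_def)
  have xe: "x $ e = (if e \<in> F then 1 else 0) - (if e = f then t else 0)" for e
  proof -
    have "incidence_vector F $ e = (t *\<^sub>R axis f 1 + c *\<^sub>R g) $ e" using eq by simp
    then show ?thesis by (simp add: x_def axis_def split: if_splits)
  qed
  have sumx: "(\<Sum>e\<in>induced_edges E U. x $ e) =
      real (card (induced_edges F U)) - (if f \<subseteq> U then t else 0)" for U
    using f sum_incidence_vector[OF FE, of U]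
    by (simp add: xe sum_subtractf) (simp add: induced_edges_def)
  show False
  proof (cases "f \<in> F")
    case True
    have "2 \<le> card (F - {f})" using F3 True by simp
    then obtain T where T: "T \<subseteq> F - {f}" "card T = 2" by (meson obtain_subset_with_card_n)
    then obtain h h' where "T = {h, h'}" "h \<noteq> h'" by (auto simp: card_2_iff)
    then have h: "h \<in> F" "h' \<in> F" "h \<noteq> f" "h' \<noteq> f" "h \<noteq> h'" using T by auto
    have rank: "(\<Sum>e\<in>induced_edges E U. x $ e) \<noteq> 0" if "h \<subseteq> U" for U
    proof -
      have "x $ h \<le> (\<Sum>e\<in>induced_edges E U. x $ e)"
        using that h FE t True by (intro member_le_sum) (auto simp: induced_edges_def xe)
      then show ?thesis using h by (simp add: xe)
    qed
    show False
      using unit_vector_excludes_circuit[OF g x_def, of h h'] rank h FE by (auto simp: xe)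
  next
    case False
    obtain h h' where h: "h \<in> F" "h' \<in> F" "h \<noteq> h'" "h' \<subseteq> f \<union> h"
      using forest_edge_pair_near_nonforest_edge[OF G F f False] by blast
    have "h \<noteq> f" using h False by blast
    have rank: "(\<Sum>e\<in>induced_edges E U. x $ e) \<noteq> 0" if hU: "h \<subseteq> U" for U
    proof (cases "f \<subseteq> U")
      case True
      \<comment> \<open>Two forest edges lie in \<open>U\<close>, so the single deficit \<open>t \<le> 1\<close> cannot cancel them.\<close>
      have "{h, h'} \<subseteq> induced_edges F U" using h hU True by (auto simp: induced_edges_def)
      then have "card {h, h'} \<le> card (induced_edges F U)" by (intro card_mono) auto
      then show ?thesis using h t True by (simp add: sumx)
    next
      case False
      have "h \<in> induced_edges F U" using h hU by (simp add: induced_edges_def)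
      then show ?thesis using False by (auto simp: sumx)
    qed
    show False
      using unit_vector_excludes_circuit[OF g x_def, of h f] rank h FE f \<open>h \<noteq> f\<close> False t
      by (auto simp: xe)
  qed
qed

section \<open>The circuit diameter\<close>

theorem theorem4p15:
  fixes V :: "'v::finite set" and E F :: "'v set set"
  assumes "simple_graph V E"
    and "card V \<ge> 4"
    and "spanning_forest V E F"
    and "card F \<ge> 3"
  shows "circuit_diameter V E \<ge> 3"
proof -
  note G = assms(1) and F = assms(3) and F3 = assms(4)
  let ?z = "incidence_vector F"
  have "0 extreme_point_of forest_polytope V E"
    by (rule zero_one_point_extreme[OF G origin_in_forest_polytope]) simp
  moreover have "?z extreme_point_of forest_polytope V E"
    by (rule zero_one_point_extreme[OF G incidence_vector_in_forest_polytope[OF G F]]) simp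
  ultimately have "circuit_distance V E 0 ?z \<le> circuit_diameter V E"
    unfolding circuit_diameter_def by (intro SUP_upper2[of "(0, ?z)"]) auto
  moreover have "3 \<le> circuit_distance V E 0 ?z"
    unfolding circuit_distance_def
  proof (rule INF_greatest)
    fix k assume "k \<in> {k. \<exists>x. circuit_walk V E k x \<and> x 0 = 0 \<and> x k = ?z}"
    then obtain x where w: "circuit_walk V E k x" and x0: "x 0 = 0" and xk: "x k = ?z" by auto
    have not_edge: "?z \<noteq> t *\<^sub>R axis f 1" for t f
    proof
      assume eq: "?z = t *\<^sub>R axis f 1"
      have "F \<subseteq> {f}"
      proof
        fix e assume "e \<in> F"
        then have "(t *\<^sub>R axis f (1::real)) $ e \<noteq> 0" using eq[symmetric] by simp
        then show "e \<in> {f}" by (auto simp: axis_def split: if_splits)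
      qed
      then show False using F3 card_mono[of "{f}" F] by simp
    qed
    have "k \<ge> 3"
    proof (rule ccontr)
      assume "\<not> k \<ge> 3"
      moreover have "k \<noteq> 0"
        using x0 xk not_edge[of 0 undefined] by (metis scaleR_zero_left)
      ultimately have k: "k = 1 \<or> k = 2" by auto
      obtain g \<epsilon> where g: "circuit V E g" "\<epsilon> > 0" "x 1 = \<epsilon> *\<^sub>R g"
        using w k x0 by (fastforce simp: circuit_walk_def)
      have "1 \<le> k" using k by auto
      then have "x 1 \<in> forest_polytope V E" using w unfolding circuit_walk_def by blast
      then have "\<epsilon> *\<^sub>R g \<in> forest_polytope V E" by (simp only: g(3))
      then obtain f t where f: "f \<in> E" "0 < t" "t \<le> 1" "x 1 = t *\<^sub>R axis f 1"
        using circuit_step_from_origin[OF G g(1,2)] g(3) by metis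
      then have "k = 2" using k xk not_edge by auto
      then obtain g' \<epsilon>' where "circuit V E g'" "?z = x 1 + \<epsilon>' *\<^sub>R g'"
        using w xk by (force simp: circuit_walk_def numeral_2_eq_2)
      then show False
        using no_circuit_step_from_edge_to_forest[OF G F F3 f(1-3)] f(4) by metis
    qed
    then show "3 \<le> enat k" by (simp add: numeral_eq_enat)
  qed
  ultimately show ?thesis by (rule order_trans[rotated])
qed

end
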